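(* Let $\boldsymbol{L}$ be a full-rank structured matrix built from jointly diagonalizable pairs $\boldsymbol{M}^{(k)},\boldsymbol{S}^{(k)}\in\mathbb{C}^{n_k\times n_k}$ ($k=1,\dots,d$), with joint diagonal entries $\lambda^{(k)}_j\neq0$ (of $\boldsymbol{U}_k\boldsymbol{M}^{(k)}\boldsymbol{V}_k$) and $\mu^{(k)}_j$ (of $\boldsymbol{U}_k\boldsymbol{S}^{(k)}\boldsymbol{V}_k$), and let $\mathcal{L}$ be the associated tensor, all as in the context. Let $\boldsymbol{X}_{(\mathcal{I}_k)}\in\mathbb{C}^{\prod_{s=1}^kn_s\times\prod_{s=k+1}^dn_s}$ be the matricization of $\mathcal{L}^{\odot-1}$ along the index set $\mathcal{I}_k=\{1,\ldots,k\}$. For each $k\in\{1,2,\ldots,d-1\}$, if there exists a closed disk $\mathcal{D}_k=\{z:|z-c|\le D\}$ in $\mathbb{C}$ such that either $$\left\{\sum_{s=1}^k\frac{\mu_{j_s}^{(s)}}{\lambda_{j_s}^{(s)}}:1\le j_s\le n_s,\ s=1,\ldots,k\right\}\subset\mathcal{D}_k\quad\text{and}\quad\left\{\sum_{s=k+1}^d-\frac{\mu_{j_s}^{(s)}}{\lambda_{j_s}^{(s)}}:1\le j_s\le n_s,\ s=k+1,\ldots,d\right\}\cap\mathcal{D}_k=\emptyset,$$ or $$\left\{\sum_{s=1}^k\frac{\mu_{j_s}^{(s)}}{\lambda_{j_s}^{(s)}}:1\le j_s\le n_s,\ s=1,\ldots,k\right\}\cap\mathcal{D}_k=\emptyset\quad\text{and}\quad\left\{\sum_{s=k+1}^d-\frac{\mu_{j_s}^{(s)}}{\lambda_{j_s}^{(s)}}:1\le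 j_s\le n_s,\ s=k+1,\ldots,d\right\}\subset\mathcal{D}_k,$$ then the singular values of $\boldsymbol{X}_{(\mathcal{I}_k)}$ decay exponentially, that is, there is a real number $q\in(0,1)$ such that $$\sigma_{j+1}\left(\boldsymbol{X}_{(\mathcal{I}_k)}\right)\le q^{j}\,\sigma_1\left(\boldsymbol{X}_{(\mathcal{I}_k)}\right)$$ for all $j=1,2,\ldots,\min\left\{\prod_{s=1}^kn_s,\prod_{s=k+1}^dn_s\right\}-1$.
   Context: Structured matrix: $\boldsymbol{L}\in\mathbb{C}^{\prod_k n_k\times\prod_k n_k}$ is a full-rank (invertible) matrix of the form $$\boldsymbol{L}=\sum_{k=1}^d\boldsymbol{M}^{(1)}\otimes\cdots\otimes\boldsymbol{M}^{(k-1)}\otimes\boldsymbol{S}^{(k)}\otimes\boldsymbol{M}^{(k+1)}\otimes\cdots\otimes\boldsymbol{M}^{(d)}$$ (Kronecker products), where for every $k$ the matrices $\boldsymbol{M}^{(k)},\boldsymbol{S}^{(k)}\in\mathbb{C}^{n_k\times n_k}$ are jointly diagonalizable: there are invertible $\boldsymbol{U}_k,\boldsymbol{V}_k\in\mathbb{C}^{n_k\times n_k}$ with $\boldsymbol{U}_k\boldsymbol{S}^{(k)}\boldsymbol{V}_k=\mathrm{diag}(\mu^{(k)}_1,\ldots,\mu^{(k)}_{n_k})$ and $\boldsymbol{U}_k\boldsymbol{M}^{(k)}\boldsymbol{V}_k=\mathrm{diag}(\lambda^{(k)}_1,\ldots,\lambda^{(k)}_{n_k})$. Associated tensor: $\mathcal{L}\in\mathbb{C}^{n_1\times\cdots\times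 n_d}$ has entries $$\mathcal{L}(j_1,\ldots,j_d)=\sum_{k=1}^d\lambda^{(1)}_{j_1}\cdots\lambda^{(k-1)}_{j_{k-1}}\mu^{(k)}_{j_k}\lambda^{(k+1)}_{j_{k+1}}\cdots\lambda^{(d)}_{j_d}.$$ These are the diagonal entries of $(\boldsymbol{U}_1\otimes\cdots\otimes\boldsymbol{U}_d)\boldsymbol{L}(\boldsymbol{V}_1\otimes\cdots\otimes\boldsymbol{V}_d)$, hence all nonzero. Its Hadamard inverse $\mathcal{L}^{\odot-1}$ is the entrywise reciprocal. Matricization: for $\mathcal{X}\in\mathbb{C}^{n_1\times\cdots\times n_d}$, $\boldsymbol{X}_{(\mathcal{I}_k)}$ is the $\prod_{s\le k}n_s\times\prod_{s>k}n_s$ matrix whose rows are indexed by $(i_1,\ldots,i_k)$ and columns by $(i_{k+1},\ldots,i_d)$ (lexicographic order), with entry $\mathcal{X}(i_1,\ldots,i_d)$. $\sigma_1\ge\sigma_2\ge\cdots$ denote the singular values of a matrix in non-increasing order. *)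

theory Defs
  imports Jordan_Normal_Form.Schur_Decomposition
begin

text \<open>
  Everything is indexed from 0, as in the matrix library: the modes are \<open>s < d\<close>, the mode
  sizes are \<open>n s\<close>, and the s-th component of a multi-index ranges over \<open>{0..<n s}\<close>.
  An order-d tensor is a function on multi-indices, which are lists of length d; its values
  outside the index range are irrelevant.
\<close>

definition kronecker :: "'a :: semiring_1 mat \<Rightarrow> 'a mat \<Rightarrow> 'a mat" where
  "kronecker A B = mat (dim_row A * dim_row B) (dim_col A * dim_col B)
     (\<lambda>(i, j). A $$ (i div dim_row B, j div dim_col B) * B $$ (i mod dim_row B, j mod dim_col B))"

definition kronecker_list :: "'a :: semiring_1 mat list \<Rightarrow> 'a mat" where
  "kronecker_list As = foldr kronecker As (1\<^sub>m 1)"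

definition structured_matrix ::
  "nat \<Rightarrow> (nat \<Rightarrow> nat) \<Rightarrow> (nat \<Rightarrow> complex mat) \<Rightarrow> (nat \<Rightarrow> complex mat) \<Rightarrow> complex mat" where
  "structured_matrix d n M S =
     foldr (+)
       (map (\<lambda>k. kronecker_list (map M [0..<k] @ [S k] @ map M [Suc k..<d])) [0..<d])
       (0\<^sub>m (\<Prod>s<d. n s) (\<Prod>s<d. n s))"

definition associated_tensor ::
  "nat \<Rightarrow> (nat \<Rightarrow> nat \<Rightarrow> complex) \<Rightarrow> (nat \<Rightarrow> nat \<Rightarrow> complex) \<Rightarrow> nat list \<Rightarrow> complex" where
  "associated_tensor d lam mu js =
     (\<Sum>k<d. (\<Prod>s<k. lam s (js ! s)) * mu k (js ! k) * (\<Prod>s\<in>{Suc k..<d}. lam s (js ! s)))"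

definition hadamard_inverse :: "(nat list \<Rightarrow> complex) \<Rightarrow> nat list \<Rightarrow> complex" where
  "hadamard_inverse T = (\<lambda>js. 1 / T js)"

text \<open>
  The multi-indices of the modes \<open>a, \<dots>, b - 1\<close> in lexicographic order (last component
  varying fastest), the order produced by \<^const>\<open>product_lists\<close>.
\<close>

definition multi_indices :: "(nat \<Rightarrow> nat) \<Rightarrow> nat \<Rightarrow> nat \<Rightarrow> nat list list" where
  "multi_indices n a b = product_lists (map (\<lambda>s. [0..<n s]) [a..<b])"

lemma length_product_lists: "length (product_lists xss) = prod_list (map length xss)"
proof (induction xss)
  case (Cons xs xss)
  have "length (concat (map (\<lambda>x. map (Cons x) yss) xs)) = length xs * length yss"
    for yss :: "'a list list"
    by (induction xs) auto
  then show ?case using Cons by simp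
qed simp

lemma length_multi_indices: "length (multi_indices n a b) = (\<Prod>s\<in>{a..<b}. n s)"
proof -
  have "(\<Prod>s\<in>{a..<b}. n s) = prod_list (map n [a..<b])"
    by (metis atLeastLessThan_upt distinct_upt prod.distinct_set_conv_list)
  then show ?thesis
    by (simp add: multi_indices_def length_product_lists comp_def)
qed

text \<open>
  The matricization along the first k modes: by \<open>@\<close>, row multi-index and column
  multi-index are joined to a full multi-index.
\<close>

definition matricization ::
  "nat \<Rightarrow> (nat \<Rightarrow> nat) \<Rightarrow> nat \<Rightarrow> (nat list \<Rightarrow> complex) \<Rightarrow> complex mat" where
  "matricization d n k T = mat (\<Prod>s<k. n s) (\<Prod>s\<in>{k..<d}. n s)
     (\<lambda>(r, c). T (multi_indices n 0 k ! r @ multi_indices n k d ! c))"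

text \<open>
  Square roots of the eigenvalues of \<open>A\<^sup>H A\<close>, with algebraic multiplicity, in non-increasing
  order; these eigenvalues are real and nonnegative, so \<^const>\<open>Re\<close> discards nothing.
  The list has \<open>dim_col A\<close> entries; those beyond position
  \<open>min (dim_row A) (dim_col A)\<close> are zero.
\<close>

definition singular_values :: "complex mat \<Rightarrow> real list" where
  "singular_values A = rev (sorted_list_of_multiset
     (image_mset (\<lambda>z. sqrt (Re z)) (proots (char_poly (mat_adjoint A * A)))))"

text \<open>Singular values are numbered from 1, so \<open>singular_value A 1\<close> is the largest one.\<close>

definition singular_value :: "complex mat \<Rightarrow> nat \<Rightarrow> real" where
  "singular_value A j = singular_values A ! (j - 1)"

definition index_sums ::
  "(nat \<Rightarrow> nat) \<Rightarrow> (nat \<Rightarrow> nat \<Rightarrow> complex) \<Rightarrow> nat set \<Rightarrow> complex set" where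
  "index_sums n f I = {\<Sum>s\<in>I. f s (j s) | j. \<forall>s\<in>I. j s < n s}"

definition closed_disk :: "complex \<Rightarrow> real \<Rightarrow> complex set" where
  "closed_disk c D = {z. cmod (z - c) \<le> D}"

end

theory Submission
  imports Defs
begin

text \<open>
  After dividing out the \<open>lam\<close>, the matricization is, up to row and column scaling, the Cauchy matrix
  \<open>1 / (a r - b c)\<close>, where the \<open>a r\<close> and the \<open>b c\<close> are separated by the disk with centre \<open>z\<close>.
  If the \<open>a r\<close> lie inside, put \<open>p r = a r - z\<close> and \<open>s c = 1 / (b c - z)\<close>; otherwise invert both. Then
  \<open>A - diag p * A * diag s\<close> has rank one, so \<open>A - (diag p)^j * A * (diag s)^j\<close> has rank at most \<open>j\<close>
  by the geometric series. On the common kernel of the \<open>j\<close> corresponding functionals, \<open>A\<close> is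
  therefore bounded by \<open>(max \<bar>p\<bar> * max \<bar>s\<bar>)^j\<close> times its norm, and this kernel meets the span of the
  first \<open>j + 1\<close> right singular vectors. There are finitely many \<open>a r\<close> and \<open>b c\<close>,
  so \<open>max \<bar>p\<bar> * max \<bar>s\<bar>\<close> is smaller than 1.
\<close>

section \<open>Unitary diagonalisation of Hermitian matrices\<close>

lemma mat_adjoint_dim [simp]:
  "dim_row (mat_adjoint A) = dim_col A" "dim_col (mat_adjoint A) = dim_row A"
  by (simp_all add: mat_adjoint_def)

lemma mat_adjoint_carrier [simp]:
  "A \<in> carrier_mat m n \<Longrightarrow> mat_adjoint A \<in> carrier_mat n m"
  by auto

lemma mat_adjoint_index [simp]:
  "i < dim_col A \<Longrightarrow> j < dim_row A \<Longrightarrow> mat_adjoint A $$ (i, j) = conjugate (A $$ (j, i))"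
  by (simp add: mat_adjoint_def mat_of_rows_def)

lemma mat_adjoint_adjoint [simp]: "mat_adjoint (mat_adjoint A) = A"
  by (rule eq_matI) auto

lemma mat_adjoint_mult:
  fixes A B :: "complex mat"
  assumes "A \<in> carrier_mat l m" "B \<in> carrier_mat m n"
  shows "mat_adjoint (A * B) = mat_adjoint B * mat_adjoint A"
  using assms by (intro eq_matI) (auto simp: scalar_prod_def mult.commute)

lemma mat_adjoint_four_block:
  assumes "A \<in> carrier_mat a b" "D \<in> carrier_mat c d"
    "B \<in> carrier_mat a d" "C \<in> carrier_mat c b"
  shows "mat_adjoint (four_block_mat A B C D) =
    four_block_mat (mat_adjoint A) (mat_adjoint C) (mat_adjoint B) (mat_adjoint D)"
  using assms by (intro eq_matI) auto

text \<open>Brings the middle pair together, so that a factor such as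
  \<open>mat_adjoint W * W\<close> becomes visible inside a conjugation by a product.\<close>

lemma mult_mat_regroup:
  fixes A B C D :: "'a :: semiring_0 mat"
  assumes "A \<in> carrier_mat a b" "B \<in> carrier_mat b c" "C \<in> carrier_mat c d" "D \<in> carrier_mat d e"
  shows "(A * B) * (C * D) = A * (B * C) * D"
proof -
  have "(A * B) * (C * D) = ((A * B) * C) * D"
    by (rule assoc_mult_mat[symmetric]) (use assms in auto)
  also have "(A * B) * C = A * (B * C)"
    by (rule assoc_mult_mat) (use assms in auto)
  finally show ?thesis .
qed

text \<open>Complete \<open>v\<close> to a basis, orthogonalise by Gram-Schmidt, which keeps the
  first vector, and normalise; the scalar \<open>a\<close> is the normalising factor of
  \<open>v\<close>.\<close>

lemma unitary_with_first_column:
  fixes v :: "complex vec"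
  assumes v: "v \<in> carrier_vec n" "v \<noteq> 0\<^sub>v n"
  obtains W a where "W \<in> carrier_mat n n" "mat_adjoint W * W = 1\<^sub>m n" "col W 0 = a \<cdot>\<^sub>v v"
proof -
  define b where "b = basis_completion v"
  define ws where "ws = gram_schmidt n b"
  interpret cof_vec_space n "TYPE(complex)" .
  note bc = basis_completion[OF v, folded b_def]
  have n: "n \<noteq> 0" using v by auto
  then obtain vs where bv: "b = v # vs" using bc by (cases b) auto
  from gram_schmidt_result[OF bc(2,4,5) refl, folded ws_def]
  have ws: "set ws \<subseteq> carrier_vec n" "corthogonal ws" "length ws = n" using bc by auto
  from gram_schmidt_hd[OF v(1), of vs, folded bv] have hdws: "hd ws = v" unfolding ws_def .
  define a where "a w = complex_of_real (1 / sqrt (Re (w \<bullet>c w)))" for w :: "complex vec"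
  define W where "W = mat_of_cols n (map (\<lambda>w. a w \<cdot>\<^sub>v w) ws)"
  have W: "W \<in> carrier_mat n n" using ws by (auto simp: W_def)
  have wc: "ws ! i \<in> carrier_vec n" if "i < n" for i
    using that ws by (metis nth_mem subsetD)
  have col: "col W i = a (ws ! i) \<cdot>\<^sub>v ws ! i" if "i < n" for i
    using that ws(3) wc[OF that] by (auto simp: W_def intro!: col_mat_of_cols[THEN trans])
  have "(mat_adjoint W * W) $$ (i, j) = 1\<^sub>m n $$ (i, j)" if ij: "i < n" "j < n" for i j
  proof -
    have "(mat_adjoint W * W) $$ (i, j) = col W j \<bullet>c col W i"
      using ij W by (auto simp: scalar_prod_def mult.commute intro!: sum.cong)
    also have "\<dots> = a (ws ! j) * cnj (a (ws ! i)) * (ws ! j \<bullet>c ws ! i)"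
      using wc[OF ij(1)] wc[OF ij(2)]
      by (simp add: col ij conjugate_smult_vec)
    also have "\<dots> = 1\<^sub>m n $$ (i, j)"
    proof (cases "i = j")
      case True
      have "ws ! i \<bullet>c ws ! i \<noteq> 0"
        using ws(2,3) ij unfolding corthogonal_def by blast
      \<comment> \<open>In the order on complex numbers, being positive includes having imaginary
        part zero, so the value is a positive real \<open>r\<close>.\<close>
      then have "ws ! i \<bullet>c ws ! i > 0"
        using conjugate_square_ge_0_vec[of "ws ! i"] by (auto simp only: order_less_le)
      then obtain r where r: "ws ! i \<bullet>c ws ! i = complex_of_real r" "r > 0"
        by (metis complex_is_Real_iff less_complex_def of_real_Re zero_complex.simps)
      have "a (ws ! i) = complex_of_real (1 / sqrt r)" by (simp only: a_def r(1) Re_complex_of_real)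
      moreover have "complex_of_real (1 / sqrt r) * cnj (complex_of_real (1 / sqrt r)) * complex_of_real r = 1"
        using r(2) by (simp flip: of_real_mult)
      ultimately show ?thesis using True ij r(1) by simp
    next
      case False
      then have "ws ! j \<bullet>c ws ! i = 0" using ws ij by (auto simp: corthogonal_def)
      then show ?thesis using False ij by simp
    qed
    finally show ?thesis .
  qed
  then have "mat_adjoint W * W = 1\<^sub>m n" using W by (intro eq_matI) auto
  moreover have "col W 0 = a v \<cdot>\<^sub>v v" using col[of 0] n hdws ws
    by (metis hd_conv_nth length_0_conv neq0_conv)
  ultimately show ?thesis using that W by blast
qed

text \<open>
  The library's Schur decomposition does not provide that its transformation is unitary, hence
  the separate induction. The eigenvalues keep the prescribed order.
\<close>

theorem hermitian_unitary_diagonalisation: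
  fixes A :: "complex mat"
  assumes "A \<in> carrier_mat n n" "mat_adjoint A = A" "char_poly A = (\<Prod>e\<leftarrow>es. [:- e, 1:])"
  shows "\<exists>P \<in> carrier_mat n n. mat_adjoint P * P = 1\<^sub>m n \<and>
    mat_adjoint P * A * P = mat_diag n ((!) es)"
  using assms
proof (induction es arbitrary: n A)
  case Nil
  then have "n = 0" using degree_monic_char_poly[of A n] by simp
  then show ?case by (intro bexI[of _ "1\<^sub>m n"]) (auto simp: mat_diag_def intro!: eq_matI)
next
  case (Cons e es)
  note A = Cons.prems(1)
  have "eigenvalue A e" by (simp add: eigenvalue_root_char_poly[OF A] Cons.prems(3))
  then obtain v where v: "v \<in> carrier_vec n" "v \<noteq> 0\<^sub>v n" and Av: "A *\<^sub>v v = e \<cdot>\<^sub>v v"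
    using A by (auto simp: eigenvalue_def eigenvector_def)
  obtain m where n: "n = Suc m" using v by (cases n) auto
  obtain W a where W: "W \<in> carrier_mat n n" "mat_adjoint W * W = 1\<^sub>m n" and W0: "col W 0 = a \<cdot>\<^sub>v v"
    using unitary_with_first_column[OF v] by metis
  define B where "B = mat_adjoint W * A * W"
  have B: "B \<in> carrier_mat n n" unfolding B_def using A W by auto
  have WW: "W * mat_adjoint W = 1\<^sub>m n"
    using mat_mult_left_right_inverse[of "mat_adjoint W" n W] W by auto
  \<comment> \<open>Similarity carries the prescribed factorisation of the characteristic polynomial
    over from \<open>A\<close> to \<open>B\<close>.\<close>
  have "similar_mat B A"
    unfolding similar_mat_def
    by (intro exI, rule similar_mat_witI[of "mat_adjoint W" W n])
      (use W WW A B in \<open>auto simp: B_def\<close>)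
  then have cB: "char_poly B = char_poly A" by (rule char_poly_similar)
  have hB: "mat_adjoint B = B"
    using A W Cons.prems(2) by (simp add: B_def mat_adjoint_mult[of _ n n _ n] assoc_mult_mat[of _ n n _ n _ n])
  \<comment> \<open>Column 0 of \<open>W\<close> is an eigenvector of \<open>A\<close>, and
    \<open>mat_adjoint W\<close> sends it to the first unit vector; so \<open>B\<close> has first
    column \<open>e\<close> times that unit vector.\<close>
  have "col B 0 = (mat_adjoint W * A) *\<^sub>v col W 0"
    unfolding B_def by (rule col_mult2[of _ n n _ n]) (use A W n in auto)
  also have "\<dots> = mat_adjoint W *\<^sub>v (A *\<^sub>v col W 0)"
    by (rule assoc_mult_mat_vec[of _ n n _ n]) (use A W v in \<open>auto simp: W0\<close>)
  also have "A *\<^sub>v col W 0 = e \<cdot>\<^sub>v col W 0"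
    using A v by (simp add: W0 Av mult_mat_vec smult_smult_assoc mult.commute)
  also have "mat_adjoint W *\<^sub>v (e \<cdot>\<^sub>v col W 0) = e \<cdot>\<^sub>v (mat_adjoint W *\<^sub>v col W 0)"
    using W by (intro mult_mat_vec[of _ n n]) auto
  also have "mat_adjoint W *\<^sub>v col W 0 = col (mat_adjoint W * W) 0"
    using W n by (intro col_mult2[of _ n n _ n, symmetric]) auto
  finally have c0: "col B 0 = e \<cdot>\<^sub>v unit_vec n 0" using W n by simp
  have B0: "B $$ (i, 0) = (if i = 0 then e else 0)" if "i < n" for i
    using arg_cong[OF c0, of "\<lambda>v. v $ i"] that B n by (auto simp: unit_vec_def)
  \<comment> \<open>Since \<open>B\<close> is Hermitian, the zeros below the corner force zeros to
    its right.\<close>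
  have B0': "B $$ (0, i) = 0" if "i < n" "i \<noteq> 0" for i
    using arg_cong[OF hB, of "\<lambda>B. B $$ (0, i)"] B0[of i] that B n by auto
  define C where "C = mat m m (\<lambda>(i, j). B $$ (Suc i, Suc j))"
  define E where "E = mat 1 1 (\<lambda>_. e)"
  have C: "C \<in> carrier_mat m m" and E: "E \<in> carrier_mat 1 1" by (auto simp: C_def E_def)
  have BC: "B = four_block_mat E (0\<^sub>m 1 m) (0\<^sub>m m 1) C"
    using B n by (intro eq_matI) (auto simp: C_def E_def B0 B0')
  have "mat_adjoint C = C"
  proof (intro eq_matI)
    fix i j assume "i < dim_row C" "j < dim_col C"
    then show "mat_adjoint C $$ (i, j) = C $$ (i, j)"
      using arg_cong[OF hB, of "\<lambda>B. B $$ (Suc i, Suc j)"] B n by (simp add: C_def)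
  qed (auto simp: C_def)
  \<comment> \<open>The characteristic polynomial of the block diagonal \<open>B\<close> is the
    product over its blocks, and the factor of the 1 by 1 block cancels, leaving \<open>es\<close>
    in order.\<close>
  moreover have "char_poly C = (\<Prod>e\<leftarrow>es. [:- e, 1:])"
  proof -
    have "char_poly E * char_poly C = [:- e, 1:] * (\<Prod>e\<leftarrow>es. [:- e, 1:])"
      using char_poly_four_block_zeros_col[OF E _ C, of "0\<^sub>m 1 m"] cB Cons.prems(3)
      by (simp add: BC)
    moreover have "char_poly E = [:- e, 1:]"
      by (simp add: E_def char_poly_defs det_def sign_def)
    ultimately show ?thesis by (metis mult_cancel_left pCons_eq_0_iff zero_neq_one)
  qed
  ultimately obtain P where P: "P \<in> carrier_mat m m" "mat_adjoint P * P = 1\<^sub>m m"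
    "mat_adjoint P * C * P = mat_diag m ((!) es)"
    using Cons.IH[OF C] by blast
  \<comment> \<open>\<open>F\<close> leaves the entry \<open>e\<close> in place and diagonalises the
    block \<open>C\<close>; the required matrix is \<open>W * F\<close>.\<close>
  define F where "F = four_block_mat (1\<^sub>m 1) (0\<^sub>m 1 m) (0\<^sub>m m 1) P"
  have F: "F \<in> carrier_mat n n" using P n by (auto simp: F_def)
  have one: "mat_adjoint (1\<^sub>m 1 :: complex mat) = 1\<^sub>m 1"
    and zero: "mat_adjoint (0\<^sub>m m 1 :: complex mat) = 0\<^sub>m 1 m"
      "mat_adjoint (0\<^sub>m 1 m :: complex mat) = 0\<^sub>m m 1"
    by (auto intro!: eq_matI)
  have aF: "mat_adjoint F = four_block_mat (1\<^sub>m 1) (0\<^sub>m 1 m) (0\<^sub>m m 1) (mat_adjoint P)"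
    unfolding F_def by (subst mat_adjoint_four_block) (use P one zero in auto)
  have "mat_adjoint F * F = 1\<^sub>m n"
    by (subst aF, unfold F_def, subst mult_four_block_mat) (use P n in \<open>auto intro!: eq_matI\<close>)
  moreover have "mat_adjoint F * B * F = mat_diag n ((!) (e # es))"
  proof -
    have "mat_adjoint F * B = four_block_mat E (0\<^sub>m 1 m) (0\<^sub>m m 1) (mat_adjoint P * C)"
      unfolding aF BC
      by (subst mult_four_block_mat[OF _ _ _ _ E _ _ C]) (use P E C in auto)
    also have "\<dots> * F = four_block_mat E (0\<^sub>m 1 m) (0\<^sub>m m 1) (mat_adjoint P * C * P)"
      unfolding F_def
      by (subst mult_four_block_mat[OF E]) (use P E C in auto)
    also have "\<dots> = mat_diag n ((!) (e # es))"
      unfolding P(3) by (rule eq_matI) (auto simp: E_def mat_diag_def n less_Suc_eq_0_disj nth_Cons' split: if_splits)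
    finally show ?thesis .
  qed
  moreover have "mat_adjoint (W * F) * (W * F) = mat_adjoint F * (mat_adjoint W * W) * F"
    unfolding mat_adjoint_mult[OF W(1) F] by (rule mult_mat_regroup[of _ n n _ n _ n _ n]) (use W F in auto)
  moreover have "mat_adjoint (W * F) * A * (W * F) = mat_adjoint F * B * F"
  proof -
    have "mat_adjoint (W * F) * A = mat_adjoint F * (mat_adjoint W * A)"
      unfolding mat_adjoint_mult[OF W(1) F] by (rule assoc_mult_mat[of _ n n _ n _ n]) (use A W F in auto)
    moreover have "\<dots> * (W * F) = mat_adjoint F * (mat_adjoint W * A * W) * F"
      by (rule mult_mat_regroup[of _ n n _ n _ n _ n]) (use A W F in auto)
    ultimately show ?thesis by (simp only: B_def)
  qed
  ultimately show ?case using W F by (intro bexI[of _ "W * F"]) auto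
qed

section \<open>Squared Euclidean norms and adjoints\<close>

definition vec_norm_sq :: "complex vec \<Rightarrow> real" where
  "vec_norm_sq v = (\<Sum>i<dim_vec v. (cmod (v $ i))\<^sup>2)"

lemma vec_norm_sq_nonneg: "0 \<le> vec_norm_sq v"
  by (simp add: vec_norm_sq_def sum_nonneg)

lemma vec_norm_sq_eq: "complex_of_real (vec_norm_sq v) = v \<bullet>c v"
  by (simp add: vec_norm_sq_def scalar_prod_def complex_norm_square lessThan_atLeast0 del: of_real_power)

lemma vec_norm_sq_pos:
  assumes "v \<in> carrier_vec n" "v \<noteq> 0\<^sub>v n"
  shows "0 < vec_norm_sq v"
proof -
  have "complex_of_real (vec_norm_sq v) \<noteq> 0"
    using assms by (simp add: vec_norm_sq_eq)
  then show ?thesis using vec_norm_sq_nonneg[of v] by simp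
qed

lemma mult_mat_vec_cscalar_prod:
  fixes A :: "complex mat"
  assumes "A \<in> carrier_mat m n" "v \<in> carrier_vec n" "w \<in> carrier_vec m"
  shows "(A *\<^sub>v v) \<bullet>c w = v \<bullet>c (mat_adjoint A *\<^sub>v w)"
proof -
  have "(A *\<^sub>v v) \<bullet>c w = (\<Sum>i<m. \<Sum>j<n. A $$ (i, j) * v $ j * cnj (w $ i))"
    using assms by (simp add: scalar_prod_def lessThan_atLeast0 sum_distrib_right)
  also have "\<dots> = (\<Sum>j<n. \<Sum>i<m. A $$ (i, j) * v $ j * cnj (w $ i))"
    by (rule sum.swap)
  also have "\<dots> = v \<bullet>c (mat_adjoint A *\<^sub>v w)"
    using assms by (simp add: scalar_prod_def lessThan_atLeast0 sum_distrib_left mult_ac)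
  finally show ?thesis .
qed

lemma vec_norm_sq_mult_mat_vec:
  assumes "A \<in> carrier_mat m n" "v \<in> carrier_vec n"
  shows "complex_of_real (vec_norm_sq (A *\<^sub>v v)) = v \<bullet>c (mat_adjoint A * A *\<^sub>v v)"
  using assms
  by (simp add: vec_norm_sq_eq mult_mat_vec_cscalar_prod[of A m n] assoc_mult_mat_vec[of _ n m _ n])

lemma vec_norm_sq_unitary:
  assumes "P \<in> carrier_mat n n" "mat_adjoint P * P = 1\<^sub>m n" "v \<in> carrier_vec n"
  shows "vec_norm_sq (P *\<^sub>v v) = vec_norm_sq v"
proof -
  have "complex_of_real (vec_norm_sq (P *\<^sub>v v)) = v \<bullet>c (1\<^sub>m n *\<^sub>v v)"
    using vec_norm_sq_mult_mat_vec[OF assms(1,3)] assms(2) by metis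
  then have "complex_of_real (vec_norm_sq (P *\<^sub>v v)) = complex_of_real (vec_norm_sq v)"
    using assms(3) by (simp add: vec_norm_sq_eq)
  then show ?thesis by simp
qed

text \<open>Pythagoras for the columns of \<open>A\<close>, which the hypothesis makes pairwise
  orthogonal with squared norms \<open>e i\<close>.\<close>

lemma vec_norm_sq_diagonal:
  assumes "A \<in> carrier_mat m n" "mat_adjoint A * A = mat_diag n e" "v \<in> carrier_vec n"
  shows "vec_norm_sq (A *\<^sub>v v) = (\<Sum>i<n. Re (e i) * (cmod (v $ i))\<^sup>2)"
proof -
  have "mat_diag n e *\<^sub>v v = vec n (\<lambda>i. e i * v $ i)"
    using assms(3)
    by (intro eq_vecI)
      (auto simp: mat_diag_def scalar_prod_def if_distrib[of "\<lambda>x. x * _"] if_distribR cong: if_cong)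
  then have "complex_of_real (vec_norm_sq (A *\<^sub>v v)) = v \<bullet>c vec n (\<lambda>i. e i * v $ i)"
    using assms by (simp add: vec_norm_sq_mult_mat_vec[of A m n])
  \<comment> \<open>The product \<open>\<bullet>c\<close> conjugates its second argument, hence
    \<open>cnj (e i)\<close>; the conjugation disappears on taking real parts.\<close>
  also have "\<dots> = (\<Sum>i<n. cnj (e i) * complex_of_real ((cmod (v $ i))\<^sup>2))"
    using assms(3) by (simp add: scalar_prod_def lessThan_atLeast0 complex_norm_square mult_ac del: of_real_power)
  finally have "Re (complex_of_real (vec_norm_sq (A *\<^sub>v v))) =
      Re (\<Sum>i<n. cnj (e i) * complex_of_real ((cmod (v $ i))\<^sup>2))" by simp
  then show ?thesis by simp
qed

section \<open>Singular values\<close>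

text \<open>Links the sorted multiset in the definition to a list of eigenvalues whose order can be
  prescribed in the diagonalisation.\<close>

lemma singular_values_eigenvalues:
  assumes "A \<in> carrier_mat m n"
  obtains es where "char_poly (mat_adjoint A * A) = (\<Prod>e\<leftarrow>es. [:- e, 1:])" "length es = n"
    "singular_values A = map (\<lambda>z. sqrt (Re z)) es"
proof -
  let ?f = "\<lambda>z. sqrt (Re z)"
  have "mat_adjoint A * A \<in> carrier_mat n n" using assms by auto
  from char_poly_factorized[OF this] obtain as where
    as: "char_poly (mat_adjoint A * A) = (\<Prod>a\<leftarrow>as. [:- a, 1:])" "length as = n" by blast
  \<comment> \<open>The complex eigenvalues are sorted by the real key \<open>?f\<close>, so that
    mapping \<open>?f\<close> over them yields the singular values in non-increasing order.\<close>
  define es where "es = rev (sort_key ?f as)"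
  have "(\<Prod>e\<leftarrow>es. [:- e, 1:]) = (\<Prod>a\<leftarrow>as. [:- a, 1:])"
    by (simp flip: prod_mset_prod_list add: es_def)
  moreover have "proots (\<Prod>a\<leftarrow>as. [:- a, 1:]) = mset as"
  proof (induction as)
    case (Cons a as)
    then show ?case
      unfolding list.map prod_list.Cons by (subst proots_mult) (auto simp: prod_list_zero_iff)
  qed simp
  then have "singular_values A = rev (sort (map ?f as))"
    by (simp add: singular_values_def as flip: mset_map)
  moreover have "sort (map ?f as) = map ?f (sort_key ?f as)"
    by (intro properties_for_sort) auto
  ultimately show ?thesis using that[of es] as by (simp add: es_def rev_map)
qed

lemma sorted_singular_values: "sorted (rev (singular_values A))"
  by (simp add: singular_values_def)

text \<open>The columns of \<open>P\<close> are right singular vectors in the order of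
  \<open>singular_values A\<close>: diagonalising \<open>mat_adjoint A * A\<close> by
  \<open>P\<close> makes the columns of \<open>A * P\<close> orthogonal.\<close>

lemma singular_values_unitary_basis:
  assumes A: "A \<in> carrier_mat m n"
  obtains P where "P \<in> carrier_mat n n" "mat_adjoint P * P = 1\<^sub>m n"
    "length (singular_values A) = n"
    "\<And>i. i < n \<Longrightarrow> 0 \<le> singular_values A ! i"
    "\<And>v. v \<in> carrier_vec n \<Longrightarrow> vec_norm_sq (A *\<^sub>v (P *\<^sub>v v)) =
      (\<Sum>i<n. (singular_values A ! i)\<^sup>2 * (cmod (v $ i))\<^sup>2)"
proof -
  obtain es where es: "char_poly (mat_adjoint A * A) = (\<Prod>e\<leftarrow>es. [:- e, 1:])" "length es = n"
    "singular_values A = map (\<lambda>z. sqrt (Re z)) es"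
    using singular_values_eigenvalues[OF A] .
  have "\<exists>P \<in> carrier_mat n n. mat_adjoint P * P = 1\<^sub>m n \<and>
      mat_adjoint P * (mat_adjoint A * A) * P = mat_diag n ((!) es)"
    using A by (intro hermitian_unitary_diagonalisation es) (auto simp: mat_adjoint_mult[of _ n m _ n])
  then obtain P where P: "P \<in> carrier_mat n n" "mat_adjoint P * P = 1\<^sub>m n"
    "mat_adjoint P * (mat_adjoint A * A) * P = mat_diag n ((!) es)" by blast
  have "mat_adjoint (A * P) * (A * P) = mat_diag n ((!) es)"
    unfolding P(3)[symmetric] mat_adjoint_mult[OF A P(1)]
    by (rule mult_mat_regroup[of _ n n _ m _ n _ n]) (use A P in auto)
  then have norm: "vec_norm_sq (A *\<^sub>v (P *\<^sub>v v)) = (\<Sum>i<n. Re (es ! i) * (cmod (v $ i))\<^sup>2)"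
    if "v \<in> carrier_vec n" for v
    using vec_norm_sq_diagonal[of "A * P" m n "(!) es" v] A P that by simp
  \<comment> \<open>The norm formula at a unit vector shows that the eigenvalue is itself a squared
    norm; hence squaring its root gives it back.\<close>
  have nonneg: "0 \<le> Re (es ! i)" if "i < n" for i
  proof -
    have "(\<Sum>l<n. Re (es ! l) * (cmod (unit_vec n i $ l))\<^sup>2) = Re (es ! i)"
      using that by (subst sum.remove[of _ i]) (auto simp: unit_vec_def intro!: sum.neutral)
    then show ?thesis
      using norm[of "unit_vec n i"] vec_norm_sq_nonneg[of "A *\<^sub>v (P *\<^sub>v unit_vec n i)"] by simp
  qed
  show ?thesis
    by (rule that[OF P(1,2)]) (auto simp: es norm nonneg)
qed

lemma singular_values_antimono:
  assumes "i \<le> j" "j < length (singular_values A)"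
  shows "singular_values A ! j \<le> singular_values A ! i"
  using sorted_singular_values[of A] assms
  by (simp add: sorted_rev_iff_nth_mono)

lemma singular_values_nonneg:
  assumes "A \<in> carrier_mat m n" "i < n"
  shows "0 \<le> singular_values A ! i"
  using assms by (metis singular_values_unitary_basis)

text \<open>The largest singular value bounds the operator norm: expand \<open>v\<close> in right
  singular vectors and replace every weight by the largest one.\<close>

lemma vec_norm_sq_mult_le:
  assumes A: "A \<in> carrier_mat m n" and v: "v \<in> carrier_vec n"
  shows "vec_norm_sq (A *\<^sub>v v) \<le> (singular_values A ! 0)\<^sup>2 * vec_norm_sq v"
proof -
  obtain P where P: "P \<in> carrier_mat n n" "mat_adjoint P * P = 1\<^sub>m n"
    "length (singular_values A) = n"
    "\<And>i. i < n \<Longrightarrow> 0 \<le> singular_values A ! i"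
    "\<And>v. v \<in> carrier_vec n \<Longrightarrow> vec_norm_sq (A *\<^sub>v (P *\<^sub>v v)) =
      (\<Sum>i<n. (singular_values A ! i)\<^sup>2 * (cmod (v $ i))\<^sup>2)"
    by (rule singular_values_unitary_basis[OF A]) (rule that)
  define w where "w = mat_adjoint P *\<^sub>v v"
  have w: "w \<in> carrier_vec n" using P(1) v by (simp add: w_def mult_mat_vec_carrier[of _ n n])
  have "P * mat_adjoint P = 1\<^sub>m n"
    using mat_mult_left_right_inverse[of "mat_adjoint P" n P] P by auto
  then have vw: "v = P *\<^sub>v w"
    using assoc_mult_mat_vec[of P n n "mat_adjoint P" n v] P(1) v by (simp add: w_def)
  have "(singular_values A ! i)\<^sup>2 \<le> (singular_values A ! 0)\<^sup>2" if "i < n" for i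
    using P(3,4) that by (intro power_mono singular_values_antimono) auto
  then have "vec_norm_sq (A *\<^sub>v v) \<le> (\<Sum>i<n. (singular_values A ! 0)\<^sup>2 * (cmod (w $ i))\<^sup>2)"
    unfolding vw P(5)[OF w] by (intro sum_mono mult_right_mono) auto
  also have "\<dots> = (singular_values A ! 0)\<^sup>2 * vec_norm_sq v"
    using w P by (simp add: vw vec_norm_sq_unitary[of P n] sum_distrib_left) (simp add: vec_norm_sq_def sum_distrib_left)
  finally show ?thesis .
qed

text \<open>Padding the \<open>j\<close> equations in \<open>j + 1\<close> unknowns with a zero row
  gives a square matrix of determinant zero, as expansion along that row shows.\<close>

lemma underdetermined_system:
  fixes f :: "nat \<Rightarrow> nat \<Rightarrow> 'a :: field"
  obtains y where "y \<in> carrier_vec (Suc j)" "y \<noteq> 0\<^sub>v (Suc j)"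
    "\<And>i. i < j \<Longrightarrow> (\<Sum>l<Suc j. f i l * y $ l) = 0"
proof -
  define K where "K = mat (Suc j) (Suc j) (\<lambda>(i, l). if i < j then f i l else 0)"
  have K: "K \<in> carrier_mat (Suc j) (Suc j)" by (simp add: K_def)
  have "det K = (\<Sum>l<Suc j. K $$ (j, l) * cofactor K j l)"
    using K by (intro laplace_expansion_row) auto
  also have "\<dots> = 0" by (simp add: K_def)
  finally obtain y where y: "y \<in> carrier_vec (Suc j)" "y \<noteq> 0\<^sub>v (Suc j)" "K *\<^sub>v y = 0\<^sub>v (Suc j)"
    using det_0_iff_vec_prod_zero_field[OF K] by blast
  have "(\<Sum>l<Suc j. f i l * y $ l) = 0" if "i < j" for i
    using arg_cong[OF y(3), of "\<lambda>v. v $ i"] that y(1)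
    by (simp add: K_def scalar_prod_def lessThan_atLeast0)
  then show ?thesis using that y by blast
qed

section \<open>Decay for matrices of displacement rank one\<close>

text \<open>The hypothesis \<open>displacement\<close> is the entrywise form of
  \<open>A - diag p * A * diag s = u * w^T\<close>. The norm of \<open>A *\<^sub>v z\<close> is
  estimated from both sides for one suitable \<open>z\<close>.\<close>

theorem singular_values_displacement:
  fixes p s u w :: "nat \<Rightarrow> complex"
  assumes A: "A \<in> carrier_mat m n"
    and displacement: "\<And>r c. r < m \<Longrightarrow> c < n \<Longrightarrow> A $$ (r, c) * (1 - p r * s c) = u r * w c"
    and p: "\<And>r. r < m \<Longrightarrow> cmod (p r) \<le> \<alpha>" and s: "\<And>c. c < n \<Longrightarrow> cmod (s c) \<le> \<beta>"
    and nonneg: "0 \<le> \<alpha>" "0 \<le> \<beta>" and j: "j < n"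
  shows "singular_values A ! j \<le> (\<alpha> * \<beta>) ^ j * singular_values A ! 0"
proof -
  let ?\<sigma> = "singular_values A"
  obtain P where P: "P \<in> carrier_mat n n" "mat_adjoint P * P = 1\<^sub>m n"
    and len: "length ?\<sigma> = n" and \<sigma>: "\<And>i. i < n \<Longrightarrow> 0 \<le> ?\<sigma> ! i"
    and AP: "\<And>v. v \<in> carrier_vec n \<Longrightarrow> vec_norm_sq (A *\<^sub>v (P *\<^sub>v v)) =
      (\<Sum>i<n. (?\<sigma> ! i)\<^sup>2 * (cmod (v $ i))\<^sup>2)"
    by (rule singular_values_unitary_basis[OF A]) (rule that)
  \<comment> \<open>The unknowns are the coordinates of \<open>z\<close> in the first
    \<open>j + 1\<close> right singular vectors; equation \<open>i\<close> says that the functional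
    with coefficients \<open>w c * s c ^ i\<close> vanishes at \<open>z\<close>.\<close>
  obtain y where y: "y \<in> carrier_vec (Suc j)" "y \<noteq> 0\<^sub>v (Suc j)"
    and y0: "\<And>i. i < j \<Longrightarrow> (\<Sum>l<Suc j. (\<Sum>c<n. w c * s c ^ i * P $$ (c, l)) * y $ l) = 0"
    by (rule underdetermined_system[of j "\<lambda>i l. \<Sum>c<n. w c * s c ^ i * P $$ (c, l)"]) (rule that)
  define v where "v = vec n (\<lambda>l. if l < Suc j then y $ l else 0)"
  have v: "v \<in> carrier_vec n" by (simp add: v_def)
  obtain l where l: "l < Suc j" "y $ l \<noteq> 0" using y by (metis eq_vecI carrier_vecD index_zero_vec)
  have "v \<noteq> 0\<^sub>v n"
  proof
    assume "v = 0\<^sub>v n"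
    then have "v $ l = 0" using l j by simp
    then show False using l j by (simp add: v_def)
  qed
  then have v_pos: "0 < vec_norm_sq v" using v vec_norm_sq_pos by blast
  define z where "z = P *\<^sub>v v"
  have z: "z \<in> carrier_vec n" using P v by (auto simp: z_def)
  have z_nth: "z $ c = (\<Sum>l<Suc j. P $$ (c, l) * y $ l)" if "c < n" for c
  proof -
    have "z $ c = (\<Sum>l<n. P $$ (c, l) * v $ l)"
      using that P v by (simp add: z_def scalar_prod_def lessThan_atLeast0)
    also have "\<dots> = (\<Sum>l<Suc j. P $$ (c, l) * y $ l)"
      by (rule sum.mono_neutral_cong_right) (use j in \<open>auto simp: v_def\<close>)
    finally show ?thesis .
  qed
  have orth: "(\<Sum>c<n. w c * s c ^ i * z $ c) = 0" if "i < j" for i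
  proof -
    have "(\<Sum>c<n. w c * s c ^ i * z $ c) =
        (\<Sum>c<n. \<Sum>l<Suc j. w c * s c ^ i * P $$ (c, l) * y $ l)"
      by (intro sum.cong refl) (simp only: z_nth lessThan_iff sum_distrib_left mult.assoc)
    also have "\<dots> = (\<Sum>l<Suc j. (\<Sum>c<n. w c * s c ^ i * P $$ (c, l)) * y $ l)"
      by (subst sum.swap) (simp only: sum_distrib_right)
    finally show ?thesis using y0[OF that] by simp
  qed
  define z' where "z' = vec n (\<lambda>c. s c ^ j * z $ c)"
  have z': "z' \<in> carrier_vec n" by (simp add: z'_def)
  have Az: "(A *\<^sub>v z) $ r = p r ^ j * (A *\<^sub>v z') $ r" if r: "r < m" for r
  proof -
    have "(A *\<^sub>v z) $ r - p r ^ j * (A *\<^sub>v z') $ r =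
        (\<Sum>c<n. A $$ (r, c) * (1 - (p r * s c) ^ j) * z $ c)"
      using A z r by (simp add: z'_def scalar_prod_def lessThan_atLeast0 sum_distrib_left
        sum_subtractf[symmetric] power_mult_distrib algebra_simps)
    \<comment> \<open>As \<open>1 - (p r * s c) ^ j\<close> is \<open>1 - p r * s c\<close> times a
      geometric sum, \<open>displacement\<close> turns the entry into \<open>j\<close> terms, each a
      factor in \<open>r\<close> times a factor in \<open>c\<close>. Summed over \<open>c\<close>,
      each vanishes by \<open>orth\<close>.\<close>
    also have "\<dots> = (\<Sum>c<n. \<Sum>i<j. u r * p r ^ i * (w c * s c ^ i * z $ c))"
    proof (intro sum.cong refl)
      fix c assume "c \<in> {..<n}"
      then have "A $$ (r, c) * (1 - (p r * s c) ^ j) * z $ c =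
          u r * w c * (\<Sum>i<j. (p r * s c) ^ i) * z $ c"
        using displacement[of r c] r by (simp add: one_diff_power_eq mult.assoc[symmetric])
      then show "A $$ (r, c) * (1 - (p r * s c) ^ j) * z $ c =
          (\<Sum>i<j. u r * p r ^ i * (w c * s c ^ i * z $ c))"
        by (simp add: sum_distrib_left sum_distrib_right power_mult_distrib mult_ac)
    qed
    also have "\<dots> = (\<Sum>i<j. u r * p r ^ i * (\<Sum>c<n. w c * s c ^ i * z $ c))"
      by (subst sum.swap) (simp add: sum_distrib_left)
    also have "\<dots> = 0" by (simp add: orth)
    finally show ?thesis by simp
  qed
  have z'_le: "vec_norm_sq z' \<le> (\<beta> ^ j)\<^sup>2 * vec_norm_sq z"
  proof -
    have "vec_norm_sq z' = (\<Sum>c<n. (cmod (s c) ^ j)\<^sup>2 * (cmod (z $ c))\<^sup>2)"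
      by (simp add: vec_norm_sq_def z'_def norm_mult norm_power power_mult_distrib)
    also have "\<dots> \<le> (\<Sum>c<n. (\<beta> ^ j)\<^sup>2 * (cmod (z $ c))\<^sup>2)"
      by (intro sum_mono mult_right_mono power_mono) (auto simp: s)
    also have "\<dots> = (\<beta> ^ j)\<^sup>2 * vec_norm_sq z"
      using z by (simp add: vec_norm_sq_def sum_distrib_left)
    finally show ?thesis .
  qed
  \<comment> \<open>Lower estimate: \<open>v\<close> is supported on positions up to
    \<open>j\<close>, where the singular values are at least \<open>?\<sigma> ! j\<close>.\<close>
  have "(?\<sigma> ! j)\<^sup>2 * vec_norm_sq v = (\<Sum>i<n. (?\<sigma> ! j)\<^sup>2 * (cmod (v $ i))\<^sup>2)"
    by (simp add: vec_norm_sq_def v_def sum_distrib_left)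
  also have "\<dots> \<le> (\<Sum>i<n. (?\<sigma> ! i)\<^sup>2 * (cmod (v $ i))\<^sup>2)"
  proof (rule sum_mono)
    fix i assume i: "i \<in> {..<n}"
    show "(?\<sigma> ! j)\<^sup>2 * (cmod (v $ i))\<^sup>2 \<le> (?\<sigma> ! i)\<^sup>2 * (cmod (v $ i))\<^sup>2"
    proof (cases "i < Suc j")
      case True
      then show ?thesis
        using j len \<sigma> by (intro mult_right_mono power_mono singular_values_antimono) auto
    qed (use i in \<open>simp add: v_def\<close>)
  qed
  also have "\<dots> = vec_norm_sq (A *\<^sub>v z)" using AP[OF v] by (simp add: z_def)
  \<comment> \<open>Upper estimate: \<open>Az\<close> releases the factor \<open>p r ^ j\<close>,
    and passing from \<open>z\<close> to \<open>z'\<close> contributes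
    \<open>\<beta> ^ j\<close>.\<close>
  also have "\<dots> = (\<Sum>r<m. (cmod (p r) ^ j)\<^sup>2 * (cmod ((A *\<^sub>v z') $ r))\<^sup>2)"
    using A Az by (simp add: vec_norm_sq_def norm_mult norm_power power_mult_distrib)
  also have "\<dots> \<le> (\<Sum>r<m. (\<alpha> ^ j)\<^sup>2 * (cmod ((A *\<^sub>v z') $ r))\<^sup>2)"
    by (intro sum_mono mult_right_mono power_mono) (auto simp: p)
  also have "\<dots> = (\<alpha> ^ j)\<^sup>2 * vec_norm_sq (A *\<^sub>v z')"
    using A by (simp add: vec_norm_sq_def sum_distrib_left)
  also have "\<dots> \<le> (\<alpha> ^ j)\<^sup>2 * ((?\<sigma> ! 0)\<^sup>2 * vec_norm_sq z')"
    by (intro mult_left_mono vec_norm_sq_mult_le[OF A z']) auto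
  also have "\<dots> \<le> (\<alpha> ^ j)\<^sup>2 * ((?\<sigma> ! 0)\<^sup>2 * ((\<beta> ^ j)\<^sup>2 * vec_norm_sq z))"
    by (intro mult_left_mono z'_le) auto
  also have "vec_norm_sq z = vec_norm_sq v"
    unfolding z_def by (rule vec_norm_sq_unitary[OF P v])
  finally have "(?\<sigma> ! j)\<^sup>2 * vec_norm_sq v \<le> ((\<alpha> * \<beta>) ^ j * ?\<sigma> ! 0)\<^sup>2 * vec_norm_sq v"
    by (simp add: power_mult_distrib mult_ac)
  then have "(?\<sigma> ! j)\<^sup>2 \<le> ((\<alpha> * \<beta>) ^ j * ?\<sigma> ! 0)\<^sup>2"
    using v_pos by simp
  then show ?thesis
    by (rule power2_le_imp_le) (use nonneg \<sigma> j in auto)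
qed

section \<open>Cauchy-like matrices with nodes separated by a disk\<close>

lemma uniform_gap:
  fixes f :: "nat \<Rightarrow> real"
  assumes "\<And>i. i < n \<Longrightarrow> D < f i"
  obtains \<delta> where "D < \<delta>" "\<And>i. i < n \<Longrightarrow> \<delta> \<le> f i"
proof
  \<comment> \<open>The extra element \<open>D + 1\<close> keeps the set nonempty when
    \<open>n\<close> is 0.\<close>
  show "D < Min (insert (D + 1) (f ` {..<n}))" using assms by auto
  show "Min (insert (D + 1) (f ` {..<n})) \<le> f i" if "i < n" for i
    using that by (intro Min_le) auto
qed

text \<open>The scalings \<open>g\<close> and \<open>h\<close> are absorbed into the vectors
  \<open>u\<close> and \<open>w\<close> of the displacement equation, so the rate depends only on
  the disk and the nodes.\<close>

theorem singular_values_cauchy_like: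
  fixes a b g h :: "nat \<Rightarrow> complex"
  assumes A: "A \<in> carrier_mat m n"
    and entries: "\<And>r c. r < m \<Longrightarrow> c < n \<Longrightarrow> A $$ (r, c) = g r * h c / (a r - b c)"
    and D: "0 \<le> D"
    and separated: "(\<forall>r<m. cmod (a r - z) \<le> D) \<and> (\<forall>c<n. D < cmod (b c - z)) \<or>
      (\<forall>r<m. D < cmod (a r - z)) \<and> (\<forall>c<n. cmod (b c - z) \<le> D)"
  shows "\<exists>q>0. q < 1 \<and> (\<forall>j<n. singular_values A ! j \<le> q ^ j * singular_values A ! 0)"
proof -
  have "\<exists>\<delta>>D. \<forall>j<n. singular_values A ! j \<le> (D / \<delta>) ^ j * singular_values A ! 0"
    using separated
  proof (elim disjE conjE)
    assume a: "\<forall>r<m. cmod (a r - z) \<le> D" and b: "\<forall>c<n. D < cmod (b c - z)"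
    obtain \<delta> where \<delta>: "D < \<delta>" "\<And>c. c < n \<Longrightarrow> \<delta> \<le> cmod (b c - z)"
      by (rule uniform_gap[of n D "\<lambda>c. cmod (b c - z)"]) (use b in auto)
    have inv: "cmod (1 / (b c - z)) \<le> 1 / \<delta>" if "c < n" for c
      using \<delta>(2)[OF that] \<delta>(1) D by (simp add: norm_divide frac_le)
    have "singular_values A ! j \<le> (D * (1 / \<delta>)) ^ j * singular_values A ! 0" if "j < n" for j
    \<comment> \<open>Here \<open>1 - p r * s c\<close> equals
      \<open>(b c - a r) / (b c - z)\<close>: the numerator cancels the Cauchy denominator up to
      sign, hence \<open>- g r\<close>.\<close>
    proof (rule singular_values_displacement[OF A, where p = "\<lambda>r. a r - z" and
          s = "\<lambda>c. 1 / (b c - z)" and u = "\<lambda>r. - g r" and w = "\<lambda>c. h c / (b c - z)"])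
      fix r c assume rc: "r < m" "c < n"
      have "a r \<noteq> b c" using a b rc by (metis not_less)
      moreover have "b c \<noteq> z" using b D rc by force
      ultimately show "A $$ (r, c) * (1 - (a r - z) * (1 / (b c - z))) = - g r * (h c / (b c - z))"
        by (simp add: entries rc divide_simps) (simp add: algebra_simps)
    qed (use a inv \<delta>(1) D that in auto)
    then show ?thesis using \<delta>(1) by auto
  next
    assume a: "\<forall>r<m. D < cmod (a r - z)" and b: "\<forall>c<n. cmod (b c - z) \<le> D"
    obtain \<delta> where \<delta>: "D < \<delta>" "\<And>r. r < m \<Longrightarrow> \<delta> \<le> cmod (a r - z)"
      by (rule uniform_gap[of m D "\<lambda>r. cmod (a r - z)"]) (use a in auto)
    have inv: "cmod (1 / (a r - z)) \<le> 1 / \<delta>" if "r < m" for r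
      using \<delta>(2)[OF that] \<delta>(1) D by (simp add: norm_divide frac_le)
    have "singular_values A ! j \<le> (1 / \<delta> * D) ^ j * singular_values A ! 0" if "j < n" for j
    \<comment> \<open>Now \<open>1 - p r * s c\<close> equals
      \<open>(a r - b c) / (a r - z)\<close>, so no sign appears and the remaining denominator goes
      into \<open>u\<close>.\<close>
    proof (rule singular_values_displacement[OF A, where p = "\<lambda>r. 1 / (a r - z)" and
          s = "\<lambda>c. b c - z" and u = "\<lambda>r. g r / (a r - z)" and w = h])
      fix r c assume rc: "r < m" "c < n"
      have "a r \<noteq> b c" using a b rc by (metis not_less)
      moreover have "a r \<noteq> z" using a D rc by force
      ultimately show "A $$ (r, c) * (1 - 1 / (a r - z) * (b c - z)) = g r / (a r - z) * h c"
        by (simp add: entries rc divide_simps)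
    qed (use b inv \<delta>(1) D that in auto)
    then show ?thesis using \<delta>(1) by auto
  qed
  then obtain \<delta> where \<delta>: "D < \<delta>"
    "\<And>j. j < n \<Longrightarrow> singular_values A ! j \<le> (D / \<delta>) ^ j * singular_values A ! 0" by blast
  \<comment> \<open>\<open>D / \<delta>\<close> is 0 for a degenerate disk.\<close>
  define q where "q = max (D / \<delta>) (1 / 2)"
  have "singular_values A ! j \<le> q ^ j * singular_values A ! 0" if j: "j < n" for j
  proof -
    have "0 \<le> singular_values A ! 0"
      using j by (intro singular_values_nonneg[OF A]) auto
    moreover have "(D / \<delta>) ^ j \<le> q ^ j"
      using D \<delta>(1) by (intro power_mono) (auto simp: q_def)
    ultimately show ?thesis using \<delta>(2)[OF j] by (meson mult_right_mono order_trans)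
  qed
  moreover have "0 < q" "q < 1" using D \<delta>(1) by (auto simp: q_def)
  ultimately show ?thesis by blast
qed

section \<open>The associated tensor\<close>

lemma multi_indices_nth:
  assumes "i < length (multi_indices n a b)"
  shows "length (multi_indices n a b ! i) = b - a"
    and "t < b - a \<Longrightarrow> multi_indices n a b ! i ! t < n (a + t)"
proof -
  have "multi_indices n a b ! i \<in> set (multi_indices n a b)" using assms by simp
  then have "list_all2 (\<lambda>x ys. x \<in> set ys) (multi_indices n a b ! i) (map (\<lambda>s. [0..<n s]) [a..<b])"
    by (simp add: multi_indices_def product_lists_set)
  then show "length (multi_indices n a b ! i) = b - a"
    and "t < b - a \<Longrightarrow> multi_indices n a b ! i ! t < n (a + t)"
    by (auto simp: list_all2_conv_all_nth)
qed

text \<open>Each summand is the full product of the \<open>lam\<close> with one factor replaced by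
  the corresponding \<open>mu\<close>, that is, the full product times their quotient.\<close>

lemma associated_tensor_factorisation:
  assumes "\<And>s. s < d \<Longrightarrow> lam s (js ! s) \<noteq> 0"
  shows "associated_tensor d lam mu js =
    (\<Prod>s<d. lam s (js ! s)) * (\<Sum>s<d. mu s (js ! s) / lam s (js ! s))"
  unfolding associated_tensor_def sum_distrib_left
proof (rule sum.cong[OF refl])
  fix k assume k: "k \<in> {..<d}"
  have split: "{..<d} = {..<k} \<union> insert k {Suc k..<d}" using k by auto
  have "(\<Prod>s<d. lam s (js ! s)) =
      (\<Prod>s<k. lam s (js ! s)) * (lam k (js ! k) * (\<Prod>s\<in>{Suc k..<d}. lam s (js ! s)))"
    unfolding split by (subst prod.union_disjoint) auto
  then show "(\<Prod>s<k. lam s (js ! s)) * mu k (js ! k) * (\<Prod>s\<in>{Suc k..<d}. lam s (js ! s)) =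
      (\<Prod>s<d. lam s (js ! s)) * (mu k (js ! k) / lam k (js ! k))"
    using assms[of k] k by simp
qed

text \<open>Splits the modes at \<open>k\<close> into a row part and a column part. Negating the
  column sum produces a difference, as in a Cauchy denominator; the shift \<open>s - k\<close>
  appears because \<open>ys\<close> starts at mode \<open>k\<close>.\<close>

lemma associated_tensor_append:
  assumes "length xs = k" "k \<le> d"
    and "\<And>s. s < k \<Longrightarrow> lam s (xs ! s) \<noteq> 0"
    and "\<And>s. k \<le> s \<Longrightarrow> s < d \<Longrightarrow> lam s (ys ! (s - k)) \<noteq> 0"
  shows "associated_tensor d lam mu (xs @ ys) =
    (\<Prod>s<k. lam s (xs ! s)) * (\<Prod>s\<in>{k..<d}. lam s (ys ! (s - k))) *
    ((\<Sum>s<k. mu s (xs ! s) / lam s (xs ! s)) -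
      (\<Sum>s\<in>{k..<d}. - (mu s (ys ! (s - k)) / lam s (ys ! (s - k)))))"
proof -
  have split: "{..<d} = {..<k} \<union> {k..<d}" using assms(2) by auto
  have "associated_tensor d lam mu (xs @ ys) =
      (\<Prod>s<d. lam s ((xs @ ys) ! s)) * (\<Sum>s<d. mu s ((xs @ ys) ! s) / lam s ((xs @ ys) ! s))"
    by (rule associated_tensor_factorisation) (use assms in \<open>auto simp: nth_append\<close>)
  also have "(\<Prod>s<d. lam s ((xs @ ys) ! s)) =
      (\<Prod>s<k. lam s (xs ! s)) * (\<Prod>s\<in>{k..<d}. lam s (ys ! (s - k)))"
    unfolding split by (subst prod.union_disjoint) (auto simp: nth_append assms(1))
  also have "(\<Sum>s<d. mu s ((xs @ ys) ! s) / lam s ((xs @ ys) ! s)) =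
      (\<Sum>s<k. mu s (xs ! s) / lam s (xs ! s)) +
      (\<Sum>s\<in>{k..<d}. mu s (ys ! (s - k)) / lam s (ys ! (s - k)))"
    unfolding split by (subst sum.union_disjoint) (auto simp: nth_append assms(1))
  finally show ?thesis by (simp add: sum_negf)
qed

theorem theorem4p6:
  fixes d :: nat and n :: "nat \<Rightarrow> nat"
    and M S U V :: "nat \<Rightarrow> complex mat"
    and lam mu :: "nat \<Rightarrow> nat \<Rightarrow> complex"
    and k :: nat
  assumes dims: "\<And>s. s < d \<Longrightarrow> 1 \<le> n s"
    and M: "\<And>s. s < d \<Longrightarrow> M s \<in> carrier_mat (n s) (n s)"
    and S: "\<And>s. s < d \<Longrightarrow> S s \<in> carrier_mat (n s) (n s)"
    and U: "\<And>s. s < d \<Longrightarrow> U s \<in> carrier_mat (n s) (n s) \<and> invertible_mat (U s)"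
    and V: "\<And>s. s < d \<Longrightarrow> V s \<in> carrier_mat (n s) (n s) \<and> invertible_mat (V s)"
    and diag_S: "\<And>s. s < d \<Longrightarrow> U s * S s * V s = mat_diag (n s) (mu s)"
    and diag_M: "\<And>s. s < d \<Longrightarrow> U s * M s * V s = mat_diag (n s) (lam s)"
    and lam_nonzero: "\<And>s j. s < d \<Longrightarrow> j < n s \<Longrightarrow> lam s j \<noteq> 0"
    and full_rank: "invertible_mat (structured_matrix d n M S)"
    and k: "k \<in> {1..d - 1}"
    and disk: "\<exists>c D. 0 \<le> D \<and>
      (index_sums n (\<lambda>s j. mu s j / lam s j) {..<k} \<subseteq> closed_disk c D \<and>
       index_sums n (\<lambda>s j. - (mu s j / lam s j)) {k..<d} \<inter> closed_disk c D = {}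
       \<or>
       index_sums n (\<lambda>s j. mu s j / lam s j) {..<k} \<inter> closed_disk c D = {} \<and>
       index_sums n (\<lambda>s j. - (mu s j / lam s j)) {k..<d} \<subseteq> closed_disk c D)"
  shows "\<exists>q::real. 0 < q \<and> q < 1 \<and>
    (\<forall>j \<in> {1..min (\<Prod>s<k. n s) (\<Prod>s\<in>{k..<d}. n s) - 1}.
       singular_value (matricization d n k (hadamard_inverse (associated_tensor d lam mu))) (j + 1)
       \<le> q ^ j *
         singular_value (matricization d n k (hadamard_inverse (associated_tensor d lam mu))) 1)"
proof -
  let ?X = "matricization d n k (hadamard_inverse (associated_tensor d lam mu))"
  let ?I = "index_sums n (\<lambda>s j. mu s j / lam s j) {..<k}"
  let ?J = "index_sums n (\<lambda>s j. - (mu s j / lam s j)) {k..<d}"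
  let ?m = "\<Prod>s<k. n s" and ?n = "\<Prod>s\<in>{k..<d}. n s"
  define R where "R r = multi_indices n 0 k ! r" for r
  define C where "C c = multi_indices n k d ! c" for c
  define a where "a r = (\<Sum>s<k. mu s (R r ! s) / lam s (R r ! s))" for r
  define b where "b c = (\<Sum>s\<in>{k..<d}. - (mu s (C c ! (s - k)) / lam s (C c ! (s - k))))" for c
  define g where "g r = 1 / (\<Prod>s<k. lam s (R r ! s))" for r
  define h where "h c = 1 / (\<Prod>s\<in>{k..<d}. lam s (C c ! (s - k)))" for c
  have kd: "k < d" using k by auto
  have R: "length (R r) = k" "\<And>s. s < k \<Longrightarrow> R r ! s < n s" if "r < ?m" for r
    using that multi_indices_nth[of r n 0 k]
    by (simp_all add: R_def length_multi_indices lessThan_atLeast0)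
  have C: "\<And>s. k \<le> s \<Longrightarrow> s < d \<Longrightarrow> C c ! (s - k) < n s" if "c < ?n" for c
  proof -
    fix s assume "k \<le> s" "s < d"
    then show "C c ! (s - k) < n s"
      using that multi_indices_nth(2)[of c n k d "s - k"] by (simp add: C_def length_multi_indices)
  qed
  have X: "?X \<in> carrier_mat ?m ?n" by (simp add: matricization_def)
  \<comment> \<open>Taking the reciprocal of the factorised tensor entry turns the two products of
    \<open>lam\<close> into the scalings \<open>g r\<close> and \<open>h c\<close>.\<close>
  have entries: "?X $$ (r, c) = g r * h c / (a r - b c)" if "r < ?m" "c < ?n" for r c
  proof -
    have "associated_tensor d lam mu (R r @ C c) =
        (\<Prod>s<k. lam s (R r ! s)) * (\<Prod>s\<in>{k..<d}. lam s (C c ! (s - k))) * (a r - b c)"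
      unfolding a_def b_def
      by (rule associated_tensor_append) (use R C lam_nonzero kd that in auto)
    then show ?thesis
      using that by (simp add: matricization_def hadamard_inverse_def R_def C_def g_def h_def)
  qed
  have a: "a r \<in> ?I" if "r < ?m" for r
    using R(2)[OF that] by (auto simp: index_sums_def a_def intro!: exI[of _ "\<lambda>s. R r ! s"])
  have b: "b c \<in> ?J" if "c < ?n" for c
    using C[OF that] by (auto simp: index_sums_def b_def intro!: exI[of _ "\<lambda>s. C c ! (s - k)"])
  obtain z D where D: "0 \<le> D" and disk: "?I \<subseteq> closed_disk z D \<and> ?J \<inter> closed_disk z D = {} \<or>
      ?I \<inter> closed_disk z D = {} \<and> ?J \<subseteq> closed_disk z D"
    using disk by blast
  have "(\<forall>r<?m. cmod (a r - z) \<le> D) \<and> (\<forall>c<?n. D < cmod (b c - z)) \<or>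
      (\<forall>r<?m. D < cmod (a r - z)) \<and> (\<forall>c<?n. cmod (b c - z) \<le> D)"
    using disk
  proof
    assume "?I \<subseteq> closed_disk z D \<and> ?J \<inter> closed_disk z D = {}"
    then have "\<forall>r<?m. a r \<in> closed_disk z D" "\<forall>c<?n. b c \<notin> closed_disk z D"
      using a b by blast+
    then show ?thesis by (simp add: closed_disk_def not_le)
  next
    assume "?I \<inter> closed_disk z D = {} \<and> ?J \<subseteq> closed_disk z D"
    then have "\<forall>r<?m. a r \<notin> closed_disk z D" "\<forall>c<?n. b c \<in> closed_disk z D"
      using a b by blast+
    then show ?thesis by (simp add: closed_disk_def not_le)
  qed
  from singular_values_cauchy_like[OF X entries D this] obtain q where
    q: "0 < q" "q < 1" "\<forall>j<?n. singular_values ?X ! j \<le> q ^ j * singular_values ?X ! 0"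
    by blast
  \<comment> \<open>Number \<open>j + 1\<close> is list position \<open>j\<close>, and the range of
    \<open>j\<close> stays below \<open>?n\<close>, the length of the list.\<close>
  have "singular_value ?X (j + 1) \<le> q ^ j * singular_value ?X 1"
    if "j \<in> {1..min ?m ?n - 1}" for j
    using q(3) that by (auto simp: singular_value_def)
  with q(1,2) show ?thesis by blast
qed

end
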